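(* Let $f_{21}^*(p_A,p_B)$ be the first-serving team's advantage in a game to $n=21$ of pickleball doubles with modified rally scoring (defined in the context), and let $q_B:=1-p_B$. For all $(p_A,p_B)\in(0,1)\times(0,1)$: if $p_A>q_B$, then $f_{21}^*(p_A,p_B)>0$ (the first-serving team has an advantage); and if $p_A<q_B$, then $f_{21}^*(p_A,p_B)<0$ (the first-serving team has a disadvantage).
   Context: Modified rally scoring chain for a game to $n$ (here $n=21$). Let $p_A$ (resp., $p_B$) be the probability that Team $A$ (resp., Team $B$) wins a rally when serving, with rallies independent. Put $q_A:=1-p_A$, $q_B:=1-p_B$. The score set is $\Sigma_n=(\{0,1,\ldots,n-1\}\times\{0,1,\ldots,n-1\})\cup\{(n-1,n),(n,n-1)\}$. The state space consists of the $2n^2+4$ states $(i,j,k)$ with $(i,j)\in\Sigma_n$ and $k\in\{1,2\}$, together with two absorbing states, "Team $A$ wins" and "Team $B$ wins". In state $(i,j,k)$, Team $A$ has $i$ points, Team $B$ has $j$ points, and it is Team $A$'s serve if $k=1$ and Team $B$'s serve if $k=2$. Effect of a point won by Team $A$ while serving at score $(i,j)$: if $i\le n-2$, the score becomes $(i+1,j)$; if $i=n-1$ and $j\le n-2$, Team $A$ wins; $(n-1,n-1)$ becomes $(n,n-1)$; $(n-1,n)$ becomes $(n-1,n-1)$; at $(n,n-1)$ Team $A$ wins. Effect of a point won by Team $B$ while serving at score $(i,j)$: if $j\le n-2$, the score becomes $(i,j+1)$; if $j=n-1$ and $i\le n-2$, Team $B$ wins; $(n-1,n-1)$ becomes $(n-1,n)$;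 $(n,n-1)$ becomes $(n-1,n-1)$; at $(n-1,n)$ Team $B$ wins. Effect of a rally won by the receiving team: if Team $B$ is receiving and wins the rally at score $(i,j)$, the score becomes $(i,j+1)$ if either ($i\le n-2$ and $j\le n-2$) or ($i=n-1$ and $j\le n-4$), and is unchanged otherwise. If Team $A$ is receiving and wins the rally at score $(i,j)$, the score becomes $(i+1,j)$ if either ($i\le n-2$ and $j\le n-2$) or ($j=n-1$ and $i\le n-4$), and is unchanged otherwise. Transitions (one step is one rally): from $(i,j,1)$, with probability $p_A$ Team $A$ wins the rally while serving, the score changes accordingly and $k$ stays $1$ (unless the game ends); with probability $q_A$ Team $B$ wins the rally while receiving, the score changes accordingly and $k$ becomes $2$. From $(i,j,2)$, with probability $p_B$ Team $B$ wins the rally while serving, the score changes accordingly and $k$ stays $2$ (unless the game ends); with probability $q_B$ Team $A$ wins the rally while receiving, the score changes accordingly and $k$ becomes $1$. The initial state is $(0,0,1)$ if Team $A$ serves first and $(0,0,2)$ if Team $B$ serves first. The first-serving team's advantage is $$f_n^*(p_A,p_B):=\mathrm{P}(\text{Team } A \text{ wins game to } n\mid \text{Team } A \text{ serves first})-\mathrm{P}(\text{Team } A \text{ wins game to } n\mid \text{Team } B \text{ serves first}),$$ where "Team $A$ wins game to $n$" is the event of absorption at "Team $A$ wins". *)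

theory Defs
  imports "HOL-Probability.Probability"
begin

subsection \<open>Discrete-time Markov chains\<close>

text \<open>
  The law, on the path space \<^typ>\<open>nat \<Rightarrow> 's\<close>, of the time-homogeneous Markov chain with transition
  kernel \<open>K\<close> and initial state \<open>s\<close>, obtained from the Ionescu Tulcea theorem.  The lemma
  \<open>chain_measure_cylinder\<close> below identifies its finite-dimensional distributions.
\<close>

definition chain_kernel :: "('s \<Rightarrow> 's pmf) \<Rightarrow> 's \<Rightarrow> nat \<Rightarrow> (nat \<Rightarrow> 's) \<Rightarrow> 's measure" where
  "chain_kernel K s i \<omega> =
     (case i of 0 \<Rightarrow> measure_pmf (return_pmf s) | Suc m \<Rightarrow> measure_pmf (K (\<omega> m)))"

definition chain_measure :: "('s \<Rightarrow> 's pmf) \<Rightarrow> 's \<Rightarrow> (nat \<Rightarrow> 's) measure" where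
  "chain_measure K s =
     projective_family.lim UNIV
       (Ionescu_Tulcea.CI (chain_kernel K s) (\<lambda>_. count_space UNIV)) (\<lambda>_. count_space UNIV)"

lemma Ionescu_Tulcea_chain_kernel:
  fixes K :: "'s \<Rightarrow> 's pmf"
  shows "Ionescu_Tulcea (chain_kernel K s) (\<lambda>_. count_space UNIV)"
proof (rule Ionescu_Tulcea.intro)
  fix i
  show "chain_kernel K s i \<in>
    measurable (PiM {0..<i} (\<lambda>_. count_space UNIV)) (subprob_algebra (count_space UNIV))"
  proof (cases i)
    case 0
    then show ?thesis
      by (simp add: chain_kernel_def[abs_def] measure_pmf_in_subprob_algebra)
  next
    case (Suc m)
    have 1: "(\<lambda>\<omega>. \<omega> m) \<in> measurable (PiM {0..<i} (\<lambda>_. count_space UNIV)) (count_space UNIV)"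
      by (rule measurable_component_singleton) (simp add: Suc)
    have 2: "(\<lambda>x. measure_pmf (K x)) \<in>
        measurable (count_space UNIV) (subprob_algebra (count_space UNIV))"
      by (simp add: measure_pmf_in_subprob_algebra)
    from measurable_compose[OF 1 2] show ?thesis
      by (simp add: chain_kernel_def[abs_def] Suc)
  qed
next
  fix i and x :: "nat \<Rightarrow> 's"
  show "prob_space (chain_kernel K s i x)"
    by (cases i) (simp_all add: chain_kernel_def prob_space_measure_pmf)
qed

lemma sets_chain_measure: "sets (chain_measure K s) = sets (PiM UNIV (\<lambda>_. count_space UNIV))"
proof -
  interpret IT: Ionescu_Tulcea "chain_kernel K s" "\<lambda>_. count_space UNIV"
    by (rule Ionescu_Tulcea_chain_kernel)
  show ?thesis by (simp add: chain_measure_def)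
qed

lemma space_chain_measure [simp]: "space (chain_measure K s) = UNIV"
  using sets_eq_imp_space_eq[OF sets_chain_measure] by (simp add: space_PiM)

lemma chain_measure_cylinder:
  fixes K :: "'s \<Rightarrow> 's pmf"
  shows "emeasure (chain_measure K s) {\<omega>. \<forall>i\<le>t. \<omega> i = x i} =
     ennreal (of_bool (x 0 = s) * (\<Prod>i<t. pmf (K (x i)) (x (Suc i))))"
proof -
  let ?M = "\<lambda>_ :: nat. count_space (UNIV :: 's set)"
  interpret IT: Ionescu_Tulcea "chain_kernel K s" ?M
    by (rule Ionescu_Tulcea_chain_kernel)
  define A where "A t = {\<omega> \<in> space (PiM {0..<Suc t} ?M). \<forall>i\<le>t. \<omega> i = x i}" for t
  have A_eq: "A t = (\<Pi>\<^sub>E i\<in>{0..<Suc t}. {x i})" for t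
    by (auto simp: A_def space_PiM PiE_iff less_Suc_eq_le extensional_def)
  have A_sets [measurable]: "A t \<in> sets (PiM {0..<Suc t} ?M)" for t
    unfolding A_eq by (rule sets_PiM_I_finite) auto
  have C: "emeasure (IT.C 0 (Suc t) (\<lambda>_. undefined)) (A t) =
      ennreal (of_bool (x 0 = s) * (\<Prod>i<t. pmf (K (x i)) (x (Suc i))))" for t
  proof (induction t)
    case 0
    have u: "(\<lambda>_. undefined) \<in> space (PiM {0..<0} ?M)" by (simp add: space_PiM)
    have "emeasure (IT.C 0 (Suc 0) (\<lambda>_. undefined)) (A 0) =
        emeasure (IT.eP 0 (\<lambda>_. undefined)) (A 0)"
      using u IT.measurable_eP[of 0] by (simp add: bind_return)
    also have "\<dots> = emeasure (return_pmf s) ((\<lambda>y. (\<lambda>_. undefined)(0 := y)) -` A 0)"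
      using IT.emeasure_eP[OF u A_sets[of 0]] by (simp add: chain_kernel_def)
    also have "(\<lambda>y. (\<lambda>_. undefined)(0 := y)) -` A 0 = {x 0}"
      by (auto simp: A_def space_PiM PiE_iff extensional_def)
    finally show ?case
      by (auto simp: emeasure_pmf_single pmf_return indicator_def)
  next
    case (Suc t)
    let ?C = "IT.C 0 (Suc t) (\<lambda>_. undefined)"
    have spC: "space ?C = space (PiM {0..<Suc t} ?M)"
      by (subst IT.space_C) (auto simp: space_PiM)
    have stC: "sets ?C = sets (PiM {0..<Suc t} ?M)"
      by (subst IT.sets_C) (auto simp: space_PiM)
    have "emeasure (IT.C 0 (Suc (Suc t)) (\<lambda>_. undefined)) (A (Suc t)) =
        emeasure (?C \<bind> IT.eP (Suc t)) (A (Suc t))"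
      by simp
    also have "\<dots> = (\<integral>\<^sup>+\<omega>. emeasure (IT.eP (Suc t) \<omega>) (A (Suc t)) \<partial>?C)"
    proof (rule emeasure_bind)
      show "space ?C \<noteq> {}" unfolding spC by (simp add: space_PiM PiE_eq_empty_iff)
      show "IT.eP (Suc t) \<in> measurable ?C (subprob_algebra (PiM {0..<Suc (Suc t)} ?M))"
        unfolding measurable_cong_sets[OF stC refl] by (rule IT.measurable_eP)
    qed (rule A_sets)
    also have "\<dots> = (\<integral>\<^sup>+\<omega>. ennreal (pmf (K (x t)) (x (Suc t))) * indicator (A t) \<omega> \<partial>?C)"
    proof (rule nn_integral_cong)
      fix \<omega> assume "\<omega> \<in> space ?C"
      then have w: "\<omega> \<in> space (PiM {0..<Suc t} ?M)" by (simp only: spC)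
      have ext: "fun_upd \<omega> (Suc t) y \<in> space (PiM {0..<Suc (Suc t)} ?M)" for y
        using w by (auto simp: space_PiM PiE_iff extensional_def)
      have "(\<lambda>y. fun_upd \<omega> (Suc t) y) -` A (Suc t) = (if \<omega> \<in> A t then {x (Suc t)} else {})"
        using w ext by (auto simp: A_def le_Suc_eq)
      then show "emeasure (IT.eP (Suc t) \<omega>) (A (Suc t)) =
          ennreal (pmf (K (x t)) (x (Suc t))) * indicator (A t) \<omega>"
        using IT.emeasure_eP[OF w A_sets[of "Suc t"]]
        by (auto simp: chain_kernel_def emeasure_pmf_single A_def)
    qed
    also have "\<dots> = ennreal (pmf (K (x t)) (x (Suc t))) * emeasure ?C (A t)"
      by (rule nn_integral_cmult_indicator) (unfold stC, rule A_sets)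
    also have "\<dots> = ennreal (of_bool (x 0 = s) * (\<Prod>i<Suc t. pmf (K (x i)) (x (Suc i))))"
      unfolding Suc.IH by (simp add: ennreal_mult[symmetric] prod_nonneg mult_ac)
    finally show ?case .
  qed
  have "{\<omega>. \<forall>i\<le>t. \<omega> i = x i} = IT.PF.emb UNIV {0..<Suc t} (A t)"
    by (auto simp: prod_emb_def A_def space_PiM less_Suc_eq_le)
  then have "emeasure (chain_measure K s) {\<omega>. \<forall>i\<le>t. \<omega> i = x i} = emeasure (IT.CI {0..<Suc t}) (A t)"
    by (simp add: chain_measure_def IT.lim)
  also have "\<dots> = emeasure (IT.C 0 (Suc t) (\<lambda>_. undefined)) (IT.PF.emb {0..<Suc t} {0..<Suc t} (A t))"
    by (rule IT.emeasure_CI) auto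
  also have "IT.PF.emb {0..<Suc t} {0..<Suc t} (A t) = A t"
    by (rule prod_emb_id) (auto simp: A_eq)
  finally show ?thesis by (simp only: C)
qed

lemma prob_space_chain_measure:
  fixes K :: "'s \<Rightarrow> 's pmf"
  shows "prob_space (chain_measure K s)"
proof -
  interpret IT: Ionescu_Tulcea "chain_kernel K s" "\<lambda>_. count_space UNIV"
    by (rule Ionescu_Tulcea_chain_kernel)
  interpret P0: prob_space "IT.CI {}"
    by (rule IT.PF.prob_space_P) simp_all
  have sp: "space (IT.CI {}) = {\<lambda>_. undefined}"
    by (simp add: IT.CI_def space_PiM)
  have "{\<lambda>_. undefined} \<in> sets (PiM {} (\<lambda>_ :: nat. count_space (UNIV :: 's set)))"
    by (simp add: sets_PiM_empty)
  from IT.lim[OF finite.emptyI this] have "emeasure (chain_measure K s) UNIV = 1"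
    using P0.emeasure_space_1
    by (simp add: chain_measure_def sp prod_emb_def restrict_def space_PiM)
  then show ?thesis by (intro prob_spaceI) simp
qed


subsection \<open>The modified rally scoring chain\<close>

datatype team = TeamA | TeamB

text \<open>\<open>Rally i j k\<close> is the state $(i,j,k)$, with the serving team in place of $k \in \{1,2\}$.\<close>

datatype state = Rally nat nat team | Wins team

definition score_set :: "nat \<Rightarrow> (nat \<times> nat) set" where
  "score_set n = {0..<n} \<times> {0..<n} \<union> {(n - 1, n), (n, n - 1)}"

definition state_space :: "nat \<Rightarrow> state set" where
  "state_space n = {Rally i j k | i j k. (i, j) \<in> score_set n} \<union> range Wins"

text \<open>
  Bounds of the form $i \le n - c$ are written \<open>i + c \<le> n\<close>, and $i = n - 1$ is written
  \<open>i + 1 = n\<close>, to avoid truncated subtraction.  The last branches of the two serving functions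
  are only reached outside \<^const>\<open>score_set\<close>.
\<close>

definition serve_win_A :: "nat \<Rightarrow> nat \<Rightarrow> nat \<Rightarrow> state" where
  "serve_win_A n i j =
     (if i + 2 \<le> n then Rally (i + 1) j TeamA
      else if i + 1 = n \<and> j + 2 \<le> n then Wins TeamA
      else if i + 1 = n \<and> j + 1 = n then Rally n (n - 1) TeamA
      else if i + 1 = n \<and> j = n then Rally (n - 1) (n - 1) TeamA
      else if i = n \<and> j + 1 = n then Wins TeamA
      else Rally i j TeamA)"

definition serve_win_B :: "nat \<Rightarrow> nat \<Rightarrow> nat \<Rightarrow> state" where
  "serve_win_B n i j =
     (if j + 2 \<le> n then Rally i (j + 1) TeamB
      else if j + 1 = n \<and> i + 2 \<le> n then Wins TeamB
      else if j + 1 = n \<and> i + 1 = n then Rally (n - 1) n TeamB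
      else if j + 1 = n \<and> i = n then Rally (n - 1) (n - 1) TeamB
      else if j = n \<and> i + 1 = n then Wins TeamB
      else Rally i j TeamB)"

definition receive_win_A :: "nat \<Rightarrow> nat \<Rightarrow> nat \<Rightarrow> state" where
  "receive_win_A n i j =
     (if (i + 2 \<le> n \<and> j + 2 \<le> n) \<or> (j + 1 = n \<and> i + 4 \<le> n)
      then Rally (i + 1) j TeamA else Rally i j TeamA)"

definition receive_win_B :: "nat \<Rightarrow> nat \<Rightarrow> nat \<Rightarrow> state" where
  "receive_win_B n i j =
     (if (i + 2 \<le> n \<and> j + 2 \<le> n) \<or> (i + 1 = n \<and> j + 4 \<le> n)
      then Rally i (j + 1) TeamB else Rally i j TeamB)"

fun rally_step :: "nat \<Rightarrow> real \<Rightarrow> real \<Rightarrow> state \<Rightarrow> state pmf" where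
  "rally_step n pA pB (Rally i j TeamA) =
     map_pmf (\<lambda>server_wins. if server_wins then serve_win_A n i j else receive_win_B n i j)
       (bernoulli_pmf pA)"
| "rally_step n pA pB (Rally i j TeamB) =
     map_pmf (\<lambda>server_wins. if server_wins then serve_win_B n i j else receive_win_A n i j)
       (bernoulli_pmf pB)"
| "rally_step n pA pB (Wins k) = return_pmf (Wins k)"

lemma rally_step_state_space:
  assumes "n \<ge> 1" and "s \<in> state_space n"
  shows "set_pmf (rally_step n pA pB s) \<subseteq> state_space n"
proof (cases s)
  case (Rally i j k)
  with assms show ?thesis
    by (cases k) (auto simp: state_space_def score_set_def serve_win_A_def serve_win_B_def
        receive_win_A_def receive_win_B_def split: if_splits)
qed (simp add: state_space_def)

definition game_measure :: "nat \<Rightarrow> real \<Rightarrow> real \<Rightarrow> team \<Rightarrow> (nat \<Rightarrow> state) measure" where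
  "game_measure n pA pB first = chain_measure (rally_step n pA pB) (Rally 0 0 first)"

definition prob_A_wins :: "nat \<Rightarrow> real \<Rightarrow> real \<Rightarrow> team \<Rightarrow> real" where
  "prob_A_wins n pA pB first = measure (game_measure n pA pB first) {\<omega>. \<exists>t. \<omega> t = Wins TeamA}"

definition first_serve_advantage :: "nat \<Rightarrow> real \<Rightarrow> real \<Rightarrow> real" where
  "first_serve_advantage n pA pB = prob_A_wins n pA pB TeamA - prob_A_wins n pA pB TeamB"

lemma sets_A_wins: "{\<omega>. \<exists>t. \<omega> t = Wins TeamA} \<in> sets (game_measure n pA pB first)"
proof -
  have "(\<lambda>\<omega>. \<omega> t) \<in> measurable (game_measure n pA pB first) (count_space UNIV)" for t :: nat
    unfolding game_measure_def
    by (subst measurable_cong_sets[OF sets_chain_measure refl])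
       (rule measurable_component_singleton, simp)
  then have "(\<lambda>\<omega>. \<omega> t) -` {Wins TeamA} \<inter> space (game_measure n pA pB first)
      \<in> sets (game_measure n pA pB first)" for t
    by (rule measurable_sets) simp
  then have "(\<Union>t. (\<lambda>\<omega>. \<omega> t) -` {Wins TeamA} \<inter> space (game_measure n pA pB first))
      \<in> sets (game_measure n pA pB first)"
    by (intro sets.countable_UN) auto
  moreover have "(\<Union>t. (\<lambda>\<omega>. \<omega> t) -` {Wins TeamA} \<inter> space (game_measure n pA pB first)) =
      {\<omega>. \<exists>t. \<omega> t = Wins TeamA}"
    by (auto simp: game_measure_def)
  ultimately show ?thesis by simp
qed

end

theory Submission
  imports Defs
begin

text \<open>
  Let $u(i,j)$ and $v(i,j)$ be the probabilities that Team A wins from score $(i,j)$ when Team A,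
  respectively Team B, serves, and put $s = p_A + p_B - 1 = p_A - q_B$.  Away from the end of the
  game, the first-step equations give $u(i,j) - v(i,j) = s w$ with $w = u(i+1,j) - v(i,j+1)$, hence
  $(1 - s) w = (u(i+1,j) - u(i,j)) + (v(i,j) - v(i,j+1))$ with $1 - s > 0$.  So it suffices that
  $u$ and $v$ are monotone in both scores, strictly so in one place.  The differences satisfy
  recurrences with nonnegative coefficients, so monotonicity propagates backwards from the end of
  the game; the freezing rules interfere only where one team has at least $n - 1$ points.
\<close>

section \<open>Distribution of the chain at a fixed time\<close>

primrec n_step :: "('s \<Rightarrow> 's pmf) \<Rightarrow> nat \<Rightarrow> 's \<Rightarrow> 's pmf" where
  "n_step K 0 s = return_pmf s"
| "n_step K (Suc t) s = bind_pmf (K s) (n_step K t)"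

text \<open>The Ionescu-Tulcea construction appends a step at the end of a path, whereas first-step
  analysis splits one off at the start. This identifies the two orders.\<close>

lemma n_step_Suc_right: "n_step K (Suc t) s = bind_pmf (n_step K t s) K"
proof (induction t arbitrary: s)
  case 0
  have "n_step K 0 = return_pmf" by (rule ext) simp
  then show ?case by (simp add: bind_return_pmf bind_return_pmf')
next
  case (Suc t)
  have "n_step K (Suc t) = (\<lambda>y. bind_pmf (n_step K t y) K)"
    using Suc.IH by (rule ext)
  then have "n_step K (Suc (Suc t)) s = bind_pmf (K s) (\<lambda>y. bind_pmf (n_step K t y) K)"
    by (metis n_step.simps(2))
  then show ?case by (simp add: bind_assoc_pmf)
qed

text \<open>The kernel reads only the last coordinate of the history, so both events can be
  evaluated on a finite stage of the construction by integrating over that coordinate. No sum over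
  paths occurs, and the state type may be arbitrary.\<close>

lemma chain_measure_step:
  fixes K :: "'s \<Rightarrow> 's pmf"
  shows "emeasure (chain_measure K s) {\<omega>. \<omega> t = x \<and> \<omega> (Suc t) \<in> B} =
     ennreal (pmf (n_step K t s) x) * emeasure (K x) B"
    and "emeasure (chain_measure K s) {\<omega>. \<omega> t \<in> A} = emeasure (n_step K t s) A"
proof -
  let ?M = "\<lambda>_ :: nat. count_space (UNIV :: 's set)"
  interpret IT: Ionescu_Tulcea "chain_kernel K s" ?M
    by (rule Ionescu_Tulcea_chain_kernel)
  let ?C = "\<lambda>t. IT.C 0 (Suc t) (\<lambda>_. undefined)"
  let ?P = "\<lambda>t. PiM {0..<Suc t} ?M"
  have spC: "space (?C t) = space (?P t)" for t
    by (subst IT.space_C) (auto simp: space_PiM)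
  have stC: "sets (?C t) = sets (?P t)" for t
    by (subst IT.sets_C) (auto simp: space_PiM)
  have comp: "(\<lambda>\<omega>. \<omega> i) \<in> measurable (?C t) (count_space UNIV)" if "i \<le> t" for i t
    unfolding measurable_cong_sets[OF stC refl]
    using that by (intro measurable_component_singleton) auto
  have compP: "(\<lambda>\<omega>. \<omega> i) \<in> measurable (?P t) (count_space UNIV)" if "i \<le> t" for i t
    using that by (intro measurable_component_singleton) auto
  have cyl: "{\<omega> \<in> space (?P (Suc t)). \<omega> t \<in> X \<and> \<omega> (Suc t) \<in> B} \<in> sets (?P (Suc t))" for t X B
  proof -
    have "{\<omega> \<in> space (?P (Suc t)). \<omega> i \<in> X} \<in> sets (?P (Suc t))" if "i \<le> Suc t" for i X
      using measurable_sets[OF compP[OF that], of X] by (simp add: vimage_def Int_def conj_commute)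
    from sets.Int[OF this[of t X] this[of "Suc t" B]] show ?thesis
      by (simp add: Int_def conj_ac cong: conj_cong)
  qed
  \<comment> \<open>One extension of the path: integrate the kernel over the histories up to time
    \<open>t\<close>, where the event restricts the new coordinate to \<open>B\<close> exactly if
    the old one lies in \<open>X\<close>.\<close>
  have step: "emeasure (?C (Suc t)) {\<omega> \<in> space (?P (Suc t)). \<omega> t \<in> X \<and> \<omega> (Suc t) \<in> B} =
      (\<integral>\<^sup>+\<omega>. indicator X (\<omega> t) * emeasure (K (\<omega> t)) B \<partial>?C t)" for t X B
  proof -
    let ?S = "{\<omega> \<in> space (?P (Suc t)). \<omega> t \<in> X \<and> \<omega> (Suc t) \<in> B}"
    have "emeasure (?C (Suc t)) ?S = emeasure (?C t \<bind> IT.eP (Suc t)) ?S"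
      by simp
    also have "\<dots> = (\<integral>\<^sup>+\<omega>. emeasure (IT.eP (Suc t) \<omega>) ?S \<partial>?C t)"
    proof (rule emeasure_bind)
      show "space (?C t) \<noteq> {}" unfolding spC by (simp add: space_PiM PiE_eq_empty_iff)
      show "IT.eP (Suc t) \<in> measurable (?C t) (subprob_algebra (?P (Suc t)))"
        unfolding measurable_cong_sets[OF stC refl] by (rule IT.measurable_eP)
    qed (rule cyl)
    also have "\<dots> = (\<integral>\<^sup>+\<omega>. indicator X (\<omega> t) * emeasure (K (\<omega> t)) B \<partial>?C t)"
    proof (rule nn_integral_cong)
      fix \<omega> assume "\<omega> \<in> space (?C t)"
      then have w: "\<omega> \<in> space (?P t)" by (simp only: spC)
      have ext: "fun_upd \<omega> (Suc t) y \<in> space (?P (Suc t))" for y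
        using w by (auto simp: space_PiM PiE_iff extensional_def)
      have "(\<lambda>y. fun_upd \<omega> (Suc t) y) -` ?S = (if \<omega> t \<in> X then B else {})"
        using ext by auto
      then show "emeasure (IT.eP (Suc t) \<omega>) ?S = indicator X (\<omega> t) * emeasure (K (\<omega> t)) B"
        using IT.emeasure_eP[OF w cyl] by (auto simp: chain_kernel_def)
    qed
    finally show ?thesis .
  qed
  have law: "distr (?C t) (count_space UNIV) (\<lambda>\<omega>. \<omega> t) = measure_pmf (n_step K t s)" for t
  proof (induction t)
    case 0
    \<comment> \<open>The constant \<open>undefined\<close> is the empty history, the only point of
      the product over no coordinates.\<close>
    have u: "(\<lambda>_. undefined) \<in> space (PiM {0..<0} ?M)" by (simp add: space_PiM)
    show ?case
    proof (rule measure_eqI)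
      fix A :: "'s set"
      let ?S = "{\<omega> \<in> space (?P 0). \<omega> 0 \<in> A}"
      have S: "?S \<in> sets (?P 0)"
        using measurable_sets[OF compP[of 0 0], of A] by (simp add: vimage_def Int_def conj_commute)
      have "emeasure (distr (?C 0) (count_space UNIV) (\<lambda>\<omega>. \<omega> 0)) A = emeasure (?C 0) ?S"
        using comp[of 0 0] by (simp add: emeasure_distr vimage_def Int_def conj_commute spC
            del: IT.C.simps)
      also have "\<dots> = emeasure (IT.eP 0 (\<lambda>_. undefined)) ?S"
        using u IT.measurable_eP[of 0] by (simp add: bind_return)
      also have "\<dots> = emeasure (return_pmf s) ((\<lambda>y. (\<lambda>_. undefined)(0 := y)) -` ?S)"
        using IT.emeasure_eP[OF u S] by (simp add: chain_kernel_def)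
      also have "(\<lambda>y. (\<lambda>_. undefined)(0 := y)) -` ?S = A"
        by (auto simp: space_PiM PiE_iff extensional_def)
      finally show "emeasure (distr (?C 0) (count_space UNIV) (\<lambda>\<omega>. \<omega> 0)) A =
          emeasure (measure_pmf (n_step K 0 s)) A" by simp
    qed simp
  next
    case (Suc t)
    show ?case
    proof (rule measure_eqI)
      fix B :: "'s set"
      have "emeasure (distr (?C (Suc t)) (count_space UNIV) (\<lambda>\<omega>. \<omega> (Suc t))) B =
          emeasure (?C (Suc t)) {\<omega> \<in> space (?P (Suc t)). \<omega> t \<in> UNIV \<and> \<omega> (Suc t) \<in> B}"
        using comp[of "Suc t" "Suc t"]
        by (simp add: emeasure_distr vimage_def Int_def conj_commute spC del: IT.C.simps)
      also have "\<dots> = (\<integral>\<^sup>+\<omega>. emeasure (K (\<omega> t)) B \<partial>?C t)"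
        unfolding step by simp
      also have "\<dots> = (\<integral>\<^sup>+x. emeasure (K x) B \<partial>distr (?C t) (count_space UNIV) (\<lambda>\<omega>. \<omega> t))"
        by (rule nn_integral_distr[symmetric]) (auto intro: comp simp del: IT.C.simps)
      also have "\<dots> = emeasure (measure_pmf (n_step K (Suc t) s)) B"
        unfolding Suc.IH n_step_Suc_right by (simp add: emeasure_bind_pmf)
      finally show "emeasure (distr (?C (Suc t)) (count_space UNIV) (\<lambda>\<omega>. \<omega> (Suc t))) B =
          emeasure (measure_pmf (n_step K (Suc t) s)) B" .
    qed simp
  qed
  \<comment> \<open>The path measure agrees with stage \<open>?C t\<close> on events that depend
    only on times up to \<open>t\<close>.\<close>
  have lim: "emeasure (chain_measure K s) {\<omega>. restrict \<omega> {0..<Suc t} \<in> S} = emeasure (?C t) S"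
    if S: "S \<in> sets (?P t)" for t S
  proof -
    have "{\<omega>. restrict \<omega> {0..<Suc t} \<in> S} = IT.PF.emb UNIV {0..<Suc t} S"
      by (auto simp: prod_emb_def space_PiM)
    then have "emeasure (chain_measure K s) {\<omega>. restrict \<omega> {0..<Suc t} \<in> S} =
        emeasure (IT.CI {0..<Suc t}) S"
      by (simp add: chain_measure_def IT.lim S)
    also have "\<dots> = emeasure (?C t) (IT.PF.emb {0..<Suc t} {0..<Suc t} S)"
      by (rule IT.emeasure_CI) (use S in auto)
    also have "IT.PF.emb {0..<Suc t} {0..<Suc t} S = S"
      using sets.sets_into_space[OF S] by (intro prod_emb_id) (simp add: space_PiM)
    finally show ?thesis .
  qed
  show "emeasure (chain_measure K s) {\<omega>. \<omega> t = x \<and> \<omega> (Suc t) \<in> B} =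
     ennreal (pmf (n_step K t s) x) * emeasure (K x) B"
  proof -
    have "{\<omega>. \<omega> t = x \<and> \<omega> (Suc t) \<in> B} = {\<omega>. restrict \<omega> {0..<Suc (Suc t)} \<in>
        {\<omega> \<in> space (?P (Suc t)). \<omega> t \<in> {x} \<and> \<omega> (Suc t) \<in> B}}"
      by (auto simp: space_PiM)
    then have "emeasure (chain_measure K s) {\<omega>. \<omega> t = x \<and> \<omega> (Suc t) \<in> B} =
        (\<integral>\<^sup>+\<omega>. indicator {x} (\<omega> t) * emeasure (K (\<omega> t)) B \<partial>?C t)"
      by (simp only: lim[OF cyl] step)
    also have "\<dots> = (\<integral>\<^sup>+y. indicator {x} y * emeasure (K y) B \<partial>distr (?C t) (count_space UNIV) (\<lambda>\<omega>. \<omega> t))"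
      by (rule nn_integral_distr[symmetric]) (auto intro: comp simp del: IT.C.simps)
    also have "\<dots> = (\<integral>\<^sup>+y. emeasure (K x) B * indicator {x} y \<partial>n_step K t s)"
      unfolding law by (intro nn_integral_cong) (auto simp: indicator_def)
    also have "\<dots> = ennreal (pmf (n_step K t s) x) * emeasure (K x) B"
      by (subst nn_integral_cmult_indicator) (simp_all add: emeasure_pmf_single mult.commute)
    finally show ?thesis .
  qed
  show "emeasure (chain_measure K s) {\<omega>. \<omega> t \<in> A} = emeasure (n_step K t s) A"
  proof -
    have eq: "{\<omega>. \<omega> t \<in> A} = {\<omega>. restrict \<omega> {0..<Suc t} \<in> {\<omega> \<in> space (?P t). \<omega> t \<in> A}}"
      by (auto simp: space_PiM)
    have S: "{\<omega> \<in> space (?P t). \<omega> t \<in> A} \<in> sets (?P t)"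
      using measurable_sets[OF compP[of t t], of A] by (simp add: vimage_def Int_def conj_commute)
    show ?thesis
      unfolding eq lim[OF S] law[symmetric] using comp[of t t]
      by (simp add: emeasure_distr vimage_def Int_def conj_commute spC del: IT.C.simps)
  qed
qed

section \<open>Hitting probabilities of an absorbing state\<close>

lemma measurable_chain_measure [measurable]:
  "(\<lambda>\<omega>. \<omega> t) \<in> measurable (chain_measure K s) (count_space UNIV)"
  by (subst measurable_cong_sets[OF sets_chain_measure refl])
    (rule measurable_component_singleton, simp)

text \<open>A path that reaches \<open>x\<close> almost surely stays there, so being at
  \<open>x\<close> at time \<open>t\<close> and having hit \<open>x\<close> by time \<open>t\<close>
  differ by a null set. The latter events increase to the hitting event, and continuity from below
  applies.\<close>

lemma hitting_absorbing_state:
  fixes K :: "'s \<Rightarrow> 's pmf"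
  assumes absorbing: "K x = return_pmf x"
  shows "(\<lambda>t. pmf (n_step K t s) x) \<longlonglongrightarrow> measure (chain_measure K s) {\<omega>. \<exists>t. \<omega> t = x}"
proof -
  interpret prob_space "chain_measure K s" by (rule prob_space_chain_measure)
  have hit: "{\<omega>. \<exists>r\<in>R. \<omega> r = x} \<in> events" for R
  proof -
    have "{\<omega> \<in> space (chain_measure K s). \<exists>r\<in>R. \<omega> r = x} \<in> events" by measurable
    then show ?thesis by simp
  qed
  \<comment> \<open>The path space does contain paths that leave \<open>x\<close>; absorption only
    makes each such departure a null event.\<close>
  have "AE \<omega> in chain_measure K s. \<omega> t = x \<longrightarrow> \<omega> (Suc t) = x" for t
  proof (rule AE_I)
    show "emeasure (chain_measure K s) {\<omega>. \<omega> t = x \<and> \<omega> (Suc t) \<in> - {x}} = 0"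
      unfolding chain_measure_step by (simp add: absorbing)
  next
    have "{\<omega> \<in> space (chain_measure K s). \<omega> t = x \<and> \<not> \<omega> (Suc t) = x} \<in> events"
      by measurable
    then show "{\<omega>. \<omega> t = x \<and> \<omega> (Suc t) \<in> - {x}} \<in> events" by simp
  qed auto
  then have AE: "AE \<omega> in chain_measure K s. \<forall>t. \<omega> t = x \<longrightarrow> \<omega> (Suc t) = x"
    by (simp add: AE_all_countable)
  have "pmf (n_step K t s) x = prob {\<omega>. \<exists>r\<le>t. \<omega> r = x}" for t
  proof -
    have "pmf (n_step K t s) x = prob {\<omega>. \<omega> t = x}"
      using chain_measure_step(2)[of K s t "{x}"]
      by (simp add: measure_def emeasure_pmf_single)
    also have "\<dots> = prob {\<omega>. \<exists>r\<le>t. \<omega> r = x}"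
    proof (rule finite_measure_eq_AE)
      show "AE \<omega> in chain_measure K s. (\<omega> \<in> {\<omega>. \<omega> t = x}) = (\<omega> \<in> {\<omega>. \<exists>r\<le>t. \<omega> r = x})"
        using AE
      proof eventually_elim
        case (elim \<omega>)
        have "\<omega> t = x" if "r \<le> t" "\<omega> r = x" for r
          using that by (induction t rule: dec_induct) (use elim in auto)
        then show ?case by auto
      qed
    qed (use hit[of "{t}"] hit[of "{..t}"] in \<open>simp_all add: Bex_def\<close>)
    finally show ?thesis .
  qed
  moreover have "(\<lambda>t. prob {\<omega>. \<exists>r\<le>t. \<omega> r = x}) \<longlonglongrightarrow> prob (\<Union>t. {\<omega>. \<exists>r\<le>t. \<omega> r = x})"
  proof (rule finite_Lim_measure_incseq)
    show "range (\<lambda>t. {\<omega>. \<exists>r\<le>t. \<omega> r = x}) \<subseteq> events"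
      using hit[of "{.._}"] by (auto simp: Bex_def)
    show "incseq (\<lambda>t. {\<omega> :: nat \<Rightarrow> 's. \<exists>r\<le>t. \<omega> r = x})"
      by (auto simp: incseq_def intro: order_trans)
  qed
  moreover have "(\<Union>t. {\<omega>. \<exists>r\<le>t. \<omega> r = x}) = {\<omega> :: nat \<Rightarrow> 's. \<exists>t. \<omega> t = x}"
    by auto
  ultimately show ?thesis by simp
qed

definition hitting_prob :: "('s \<Rightarrow> 's pmf) \<Rightarrow> 's \<Rightarrow> 's \<Rightarrow> real" where
  "hitting_prob K x s = measure (chain_measure K s) {\<omega>. \<exists>t. \<omega> t = x}"

lemma hitting_prob_bounds: "0 \<le> hitting_prob K x s" "hitting_prob K x s \<le> 1"
  using prob_space.prob_le_1[OF prob_space_chain_measure] by (simp_all add: hitting_prob_def)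

lemma hitting_prob_absorbing:
  assumes "K x = return_pmf x" "K y = return_pmf y"
  shows "hitting_prob K x y = of_bool (y = x)"
proof -
  have "n_step K t y = return_pmf y" for t
    by (induction t) (simp_all add: assms(2) bind_return_pmf)
  then have "(\<lambda>t. of_bool (y = x) :: real) \<longlonglongrightarrow> hitting_prob K x y"
    using hitting_absorbing_state[of K x y, OF assms(1)]
    by (simp add: hitting_prob_def pmf_return indicator_def of_bool_def eq_commute)
  then show ?thesis by (simp add: LIMSEQ_const_iff)
qed

text \<open>The recursion of \<open>n_step\<close> gives this equation with time
  \<open>t + 1\<close> on the left and \<open>t\<close> on the right; letting \<open>t\<close> tend
  to infinity avoids a Markov property for shifted paths.\<close>

lemma hitting_prob_first_step:
  assumes x: "K x = return_pmf x" and s: "K s = map_pmf f (bernoulli_pmf p)" and p: "0 \<le> p" "p \<le> 1"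
  shows "hitting_prob K x s = p * hitting_prob K x (f True) + (1 - p) * hitting_prob K x (f False)"
proof (rule LIMSEQ_unique)
  note lim = hitting_absorbing_state[of K x, OF x, folded hitting_prob_def]
  show "(\<lambda>t. pmf (n_step K (Suc t) s) x) \<longlonglongrightarrow> hitting_prob K x s"
    by (rule LIMSEQ_Suc) (rule lim)
  have "pmf (n_step K (Suc t) s) x =
      p * pmf (n_step K t (f True)) x + (1 - p) * pmf (n_step K t (f False)) x" for t
    using p by (simp add: s bind_map_pmf pmf_bind)
  then show "(\<lambda>t. pmf (n_step K (Suc t) s) x) \<longlonglongrightarrow>
      p * hitting_prob K x (f True) + (1 - p) * hitting_prob K x (f False)"
    by (simp only:) (intro tendsto_intros lim)
qed

section \<open>The system of first-step equations and its symmetry\<close>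

text \<open>
  The game is to \<open>m + 4\<close>, so that all scores at which the rules change are sums; \<open>u i j\<close> and \<open>v i j\<close>
  stand for the probability that Team A wins from score $(i,j)$ with Team A, respectively Team B,
  serving.
\<close>

locale rally_values =
  fixes m :: nat and a b :: real and u v :: "nat \<Rightarrow> nat \<Rightarrow> real"
  assumes a: "0 < a" "a < 1" and b: "0 < b" "b < 1"
    and u01: "0 \<le> u i j" "u i j \<le> 1" and v01: "0 \<le> v i j" "v i j \<le> 1"
    and u_mid: "i \<le> m + 2 \<Longrightarrow> j \<le> m + 2 \<Longrightarrow> u i j = a * u (i + 1) j + (1 - a) * v i (j + 1)"
    and v_mid: "i \<le> m + 2 \<Longrightarrow> j \<le> m + 2 \<Longrightarrow> v i j = b * v i (j + 1) + (1 - b) * u (i + 1) j"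
    and u_row: "j \<le> m \<Longrightarrow> u (m + 3) j = a + (1 - a) * v (m + 3) (j + 1)"
      "j = m + 1 \<or> j = m + 2 \<Longrightarrow> u (m + 3) j = a + (1 - a) * v (m + 3) j"
    and v_row: "j \<le> m + 2 \<Longrightarrow> v (m + 3) j = b * v (m + 3) (j + 1) + (1 - b) * u (m + 3) j"
    and v_col: "i \<le> m \<Longrightarrow> v i (m + 3) = (1 - b) * u (i + 1) (m + 3)"
      "i = m + 1 \<or> i = m + 2 \<Longrightarrow> v i (m + 3) = (1 - b) * u i (m + 3)"
    and u_col: "i \<le> m + 2 \<Longrightarrow> u i (m + 3) = a * u (i + 1) (m + 3) + (1 - a) * v i (m + 3)"
    and u_tie: "u (m + 3) (m + 3) = a * u (m + 4) (m + 3) + (1 - a) * v (m + 3) (m + 3)"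
    and v_tie: "v (m + 3) (m + 3) = b * v (m + 3) (m + 4) + (1 - b) * u (m + 3) (m + 3)"
    and u_A_up: "u (m + 4) (m + 3) = a + (1 - a) * v (m + 4) (m + 3)"
    and v_A_up: "v (m + 4) (m + 3) = b * v (m + 3) (m + 3) + (1 - b) * u (m + 4) (m + 3)"
    and u_B_up: "u (m + 3) (m + 4) = a * u (m + 3) (m + 3) + (1 - a) * v (m + 3) (m + 4)"
    and v_B_up: "v (m + 3) (m + 4) = (1 - b) * u (m + 3) (m + 4)"
begin

text \<open>In each equation the weights sum to 1, with value 1 or 0 where the game ends, so
  complementary values satisfy the equations of Team B's chances. Exchanging the teams then returns
  the same system, and every result about Team A's score yields one about Team B's.\<close>

lemma swap: "rally_values m b a (\<lambda>i j. 1 - v j i) (\<lambda>i j. 1 - u j i)"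
proof (rule rally_values.intro, goal_cases)
  case (9 i j)
  show ?case using v_mid[OF 9(2,1)] by algebra
next
  case (10 i j)
  show ?case using u_mid[OF 10(2,1)] by algebra
next
  case (11 j)
  show ?case using v_col(1)[OF 11] by algebra
next
  case (12 j)
  show ?case using v_col(2)[OF 12] by algebra
next
  case (13 j)
  show ?case using u_col[OF 13] by algebra
next
  case (14 i)
  show ?case using u_row(1)[OF 14] by algebra
next
  case (15 i)
  show ?case using u_row(2)[OF 15] by algebra
next
  case (16 i)
  show ?case using v_row[OF 16] by algebra
next
  case 17
  show ?case using v_tie by algebra
next
  case 18
  show ?case using u_tie by algebra
next
  case 19
  show ?case using v_B_up by algebra
next
  case 20
  show ?case using u_B_up by algebra
next
  case 21
  show ?case using v_A_up by algebra
next
  case 22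
  show ?case using u_A_up by algebra
qed (simp_all add: a b u01 v01)

section \<open>Monotonicity of the winning probabilities in both scores\<close>

text \<open>A lost rally can leave the score unchanged, so a value may occur in its own recurrence.\<close>

lemma fixed_point_nonneg:
  assumes "du = x + (1 - a) * dv" "dv = y + (1 - b) * du" "0 \<le> x" "0 \<le> y"
  shows "0 \<le> (du :: real)" "0 \<le> dv"
proof -
  have "(1 - a) * (1 - b) < 1 * 1"
    using a b by (intro mult_strict_mono) auto
  then have pos: "0 < 1 - (1 - a) * (1 - b)" by simp
  \<comment> \<open>Substitute the second equation into the first to eliminate
    \<open>dv\<close>.\<close>
  have "(1 - (1 - a) * (1 - b)) * du = x + (1 - a) * y"
    using assms(1,2) by (simp add: algebra_simps)
  also have "\<dots> \<ge> 0" using assms(3,4) a by simp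
  finally show "0 \<le> du" using pos by (simp add: zero_le_mult_iff)
  then show "0 \<le> dv" using assms(2,4) b by simp
qed

text \<open>In this column Team B is one point short of winning, and the backward induction of
  \<open>mono_A\<close> starts here. Team A's receiving wins score only for
  \<open>i \<le> m\<close>, so the differences at \<open>m + 2\<close>, at \<open>m + 1\<close>, at
  \<open>m\<close> and below \<open>m\<close> obey four different recurrences.\<close>

lemma col_mono:
  assumes "i \<le> m + 2"
  shows "u i (m + 3) \<le> u (i + 1) (m + 3) \<and> v i (m + 3) \<le> v (i + 1) (m + 3)"
proof -
  let ?du = "\<lambda>i. u (i + 1) (m + 3) - u i (m + 3)" and ?dv = "\<lambda>i. v (i + 1) (m + 3) - v i (m + 3)"
  have top: "0 \<le> ?du (m + 2)" "0 \<le> ?dv (m + 2)"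
  proof -
    let ?U = "u (m + 3) (m + 3)"
    \<comment> \<open>Both values at \<open>m + 2\<close> are compared with the single number
      \<open>?U\<close>, because \<open>v (m + 3) (m + 3)\<close> follows the tie rule and involves
      the score with Team B at \<open>m + 4\<close>.\<close>
    have du: "?U - u (m + 2) (m + 3) = 0 + (1 - a) * (?U - v (m + 2) (m + 3))"
      using u_col[of "m + 2"] by (simp add: algebra_simps numeral_3_eq_3)
    have dv: "?U - v (m + 2) (m + 3) = b * ?U + (1 - b) * (?U - u (m + 2) (m + 3))"
      using v_col(2)[of "m + 2"] by (simp add: algebra_simps)
    have "0 \<le> b * ?U" using u01 b by simp
    from fixed_point_nonneg(1)[OF du dv order_refl this]
    have "0 \<le> ?U - u (m + 2) (m + 3)" .
    then show le: "0 \<le> ?du (m + 2)" by (simp add: numeral_3_eq_3)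
    have "v (m + 2) (m + 3) \<le> (1 - b) * ?U"
      using v_col(2)[of "m + 2"] le b by (simp add: mult_left_mono numeral_3_eq_3)
    also have "\<dots> \<le> v (m + 3) (m + 3)"
      using v_tie v01[of "m + 3" "m + 4"] b by simp
    finally show "0 \<le> ?dv (m + 2)" by (simp add: numeral_3_eq_3)
  qed
  have sec: "0 \<le> ?du (m + 1)" "0 \<le> ?dv (m + 1)"
  proof -
    \<comment> \<open>The score is frozen at both \<open>m + 1\<close> and \<open>m + 2\<close> when
      Team A wins on receive, so \<open>?du\<close> and \<open>?dv\<close> at \<open>m + 1\<close>
      refer to each other.\<close>
    have du: "?du (m + 1) = a * ?du (m + 2) + (1 - a) * ?dv (m + 1)"
      using u_col[of "m + 1"] u_col[of "m + 2"] by (simp add: algebra_simps numeral_3_eq_3)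
    have dv: "?dv (m + 1) = 0 + (1 - b) * ?du (m + 1)"
      using v_col(2)[of "m + 1"] v_col(2)[of "m + 2"] by (simp add: algebra_simps)
    have "0 \<le> a * ?du (m + 2)" using top(1) a by simp
    from fixed_point_nonneg[OF du dv this order_refl]
    show "0 \<le> ?du (m + 1)" "0 \<le> ?dv (m + 1)" .
  qed
  show ?thesis
    using assms
  proof (induction i rule: inc_induct)
    case base
    then show ?case using top by simp
  next
    case (step i)
    consider "i = m + 1" | "i = m" | "i < m" using step by linarith
    then show ?case
    proof cases
      case 1
      then show ?thesis using sec by simp
    next
      case 2
      \<comment> \<open>A receiving win takes Team A from \<open>m\<close> to \<open>m + 1\<close>
        but leaves it at \<open>m + 1\<close> if already there. Both lead to the same state, so the
        two \<open>v\<close> values coincide.\<close>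
      have "?dv i = 0" using v_col(1)[of m] v_col(2)[of "m + 1"] 2 by simp
      moreover have "?du i = a * ?du (i + 1) + (1 - a) * ?dv i"
        using u_col[of i] u_col[of "i + 1"] 2 by (simp add: algebra_simps)
      ultimately have "0 \<le> ?dv i" "0 \<le> ?du i" using step.IH a by simp_all
      then show ?thesis by simp
    next
      case 3
      have "?dv i = (1 - b) * ?du (i + 1)"
        using v_col(1)[of i] v_col(1)[of "i + 1"] 3 by (simp add: algebra_simps)
      then have dv: "0 \<le> ?dv i" using step.IH b by simp
      have "?du i = a * ?du (i + 1) + (1 - a) * ?dv i"
        using u_col[of i] u_col[of "i + 1"] 3 by (simp add: algebra_simps)
      then have "0 \<le> ?du i" using step.IH a dv by simp
      then show ?thesis using dv by simp
    qed
  qed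
qed

lemma row_antimono:
  assumes "j \<le> m + 2"
  shows "u (m + 3) (j + 1) \<le> u (m + 3) j \<and> v (m + 3) (j + 1) \<le> v (m + 3) j"
  using rally_values.col_mono[OF swap assms] by simp

text \<open>Double backward induction, outer in Team B's score from \<open>col_mono\<close>, inner
  in Team A's. In the interior each difference is a convex combination of the differences at
  \<open>(i + 1, j)\<close> and \<open>(i, j + 1)\<close>; only the step from \<open>m + 2\<close>
  to \<open>m + 3\<close> compares different rules.\<close>

lemma mono_A:
  assumes "i \<le> m + 2" "j \<le> m + 3"
  shows "u i j \<le> u (i + 1) j \<and> v i j \<le> v (i + 1) j"
  using assms(2,1)
proof (induction j arbitrary: i rule: inc_induct)
  case base
  then show ?case using col_mono by blast
next
  case (step j)
  have j: "j \<le> m + 2" using step.hyps by simp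
  note IH_j = step.IH
  from step.prems show ?case
  proof (induction i rule: inc_induct)
    case base
    have IH: "v (m + 2) (j + 1) \<le> v (m + 3) (j + 1)"
      using step.IH[of "m + 2"] by (simp add: numeral_3_eq_3)
    have um: "u (m + 2) j = a * u (m + 3) j + (1 - a) * v (m + 2) (j + 1)"
      using u_mid[of "m + 2" j] j by (simp add: numeral_3_eq_3)
    \<comment> \<open>If Team A wins on receive, it reaches \<open>m + 3\<close> from
      \<open>m + 2\<close> and stays at \<open>m + 3\<close> by freezing, so the \<open>u\<close>
      terms cancel.\<close>
    have "v (m + 3) j - v (m + 2) j = b * (v (m + 3) (j + 1) - v (m + 2) (j + 1))"
      using v_mid[of "m + 2" j] v_row[of j] j by (simp add: algebra_simps numeral_3_eq_3)
    then have "0 \<le> v (m + 3) j - v (m + 2) j" using IH b by simp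
    then have v: "v (m + 2) j \<le> v (m + 3) j" by simp
    obtain x where x: "u (m + 3) j = a + (1 - a) * x" "v (m + 3) (j + 1) \<le> x"
    proof (cases "j \<le> m")
      case True
      then show ?thesis using that u_row(1) by blast
    next
      case False
      then have "j = m + 1 \<or> j = m + 2" using j by linarith
      then show ?thesis using that u_row(2) row_antimono[OF j] by blast
    qed
    have "u (m + 3) j - u (m + 2) j = a * (1 - u (m + 3) j) + (1 - a) * (x - v (m + 2) (j + 1))"
      using um x(1) by algebra
    also have "\<dots> \<ge> 0" using a u01(2)[of "m + 3" j] IH x(2) by (intro add_nonneg_nonneg mult_nonneg_nonneg) auto
    finally show ?case using v by (simp add: numeral_3_eq_3)
  next
    case (step i)
    have IH: "v i (j + 1) \<le> v (i + 1) (j + 1)"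
      using IH_j[of i] step.hyps by simp
    have i: "i \<le> m + 2" "i + 1 \<le> m + 2" using step.hyps by simp_all
    have "u (i + 1) j - u i j =
        a * (u (i + 1 + 1) j - u (i + 1) j) + (1 - a) * (v (i + 1) (j + 1) - v i (j + 1))"
      using u_mid[OF i(1) j] u_mid[OF i(2) j] by algebra
    moreover have "v (i + 1) j - v i j =
        b * (v (i + 1) (j + 1) - v i (j + 1)) + (1 - b) * (u (i + 1 + 1) j - u (i + 1) j)"
      using v_mid[OF i(1) j] v_mid[OF i(2) j] by algebra
    ultimately have "0 \<le> u (i + 1) j - u i j" "0 \<le> v (i + 1) j - v i j"
      using step.IH IH a b by simp_all
    then show ?case by simp
  qed
qed

lemma antimono_B:
  assumes "i \<le> m + 3" "j \<le> m + 2"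
  shows "u i (j + 1) \<le> u i j \<and> v i (j + 1) \<le> v i j"
  using rally_values.mono_A[OF swap assms(2,1)] by simp

section \<open>Strictness and the sign of the serving advantage\<close>

lemma u_col_pos:
  assumes "i \<le> m + 3"
  shows "0 < u i (m + 3)"
  using assms
proof (induction i rule: inc_induct)
  case base
  \<comment> \<open>From the tie, Team A wins by taking two serves in a row.\<close>
  have "0 < a * a" using a by simp
  also have "a * a \<le> a * u (m + 4) (m + 3)"
    using u_A_up v01[of "m + 4" "m + 3"] a by (intro mult_left_mono) auto
  also have "\<dots> \<le> u (m + 3) (m + 3)"
    using u_tie v01[of "m + 3" "m + 3"] a by simp
  finally show ?case .
next
  case (step i)
  have "0 < a * u (Suc i) (m + 3)" using step.IH a by simp
  also have "\<dots> \<le> u i (m + 3)"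
    using u_col[of i] v01[of i "m + 3"] a step.hyps by simp
  finally show ?case .
qed

text \<open>Positivity of \<open>v 0 (m + 3)\<close> makes the last difference strict, and the
  coefficient \<open>b > 0\<close> carries strictness back to \<open>j = 0\<close>; the remaining
  terms are nonnegative by \<open>antimono_B\<close>.\<close>

lemma v_strict_antimono_B:
  assumes "j \<le> m + 2"
  shows "v 0 (j + 1) < v 0 j"
  using assms
proof (induction j rule: inc_induct)
  case base
  \<comment> \<open>At \<open>(0, m + 3)\<close> a serving win of Team B ends the game with value 0,
    so nothing is subtracted from \<open>b * v 0 (m + 3)\<close>.\<close>
  have "v 0 (m + 2) - v 0 (m + 3) = b * v 0 (m + 3) + (1 - b) * (u 1 (m + 2) - u 1 (m + 3))"
    using v_mid[of 0 "m + 2"] v_col(1)[of 0] by (simp add: algebra_simps numeral_3_eq_3)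
  moreover have "0 < v 0 (m + 3)"
    using v_col(1)[of 0] u_col_pos[of 1] b by simp
  moreover have "u 1 (m + 3) \<le> u 1 (m + 2)"
    using antimono_B[of 1 "m + 2"] by (simp add: numeral_3_eq_3)
  ultimately have "0 < v 0 (m + 2) - v 0 (m + 3)"
    using b by (simp add: add_pos_nonneg)
  then show ?case by (simp add: numeral_3_eq_3)
next
  case (step j)
  have "v 0 j - v 0 (j + 1) = b * (v 0 (j + 1) - v 0 (j + 2)) + (1 - b) * (u 1 j - u 1 (j + 1))"
    using v_mid[of 0 j] v_mid[of 0 "j + 1"] step.hyps by (simp add: algebra_simps)
  moreover have "u 1 (j + 1) \<le> u 1 j"
    using antimono_B[of 1 j] step.hyps by simp
  ultimately have "0 < v 0 j - v 0 (j + 1)"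
    using b step.IH by (simp add: add_pos_nonneg)
  then show ?case by simp
qed

lemma serve_advantage:
  obtains w where "0 < w" "u 0 0 - v 0 0 = (a + b - 1) * w"
proof
  let ?w = "u 1 0 - v 0 1"
  show eq: "u 0 0 - v 0 0 = (a + b - 1) * ?w"
    using u_mid[of 0 0] v_mid[of 0 0] by (simp add: algebra_simps)
  have "(2 - a - b) * ?w = ?w - (u 0 0 - v 0 0)"
    unfolding eq by (simp add: algebra_simps)
  also have "\<dots> = (u 1 0 - u 0 0) + (v 0 0 - v 0 1)" by simp
  also have "\<dots> > 0"
    using mono_A[of 0 0] v_strict_antimono_B[of 0] by simp
  finally show "0 < ?w" using a b by (simp add: zero_less_mult_iff)
qed

end

section \<open>The rally scoring chain satisfies the system\<close>

lemma rally_values_hitting_prob: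
  fixes m :: nat and pA pB :: real
  assumes pA: "0 < pA" "pA < 1" and pB: "0 < pB" "pB < 1"
  defines "H \<equiv> hitting_prob (rally_step (m + 4) pA pB) (Wins TeamA)"
  shows "rally_values m pA pB (\<lambda>i j. H (Rally i j TeamA)) (\<lambda>i j. H (Rally i j TeamB))"
proof -
  have W: "H (Wins TeamA) = 1" "H (Wins TeamB) = 0"
    by (simp_all add: H_def hitting_prob_absorbing)
  have A: "H (Rally i j TeamA) =
      pA * H (serve_win_A (m + 4) i j) + (1 - pA) * H (receive_win_B (m + 4) i j)" for i j
    unfolding H_def
    by (subst hitting_prob_first_step[where p = pA and f = "\<lambda>w. if w then _ else _"])
      (use pA in auto)
  have B: "H (Rally i j TeamB) =
      pB * H (serve_win_B (m + 4) i j) + (1 - pB) * H (receive_win_A (m + 4) i j)" for i j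
    unfolding H_def
    by (subst hitting_prob_first_step[where p = pB and f = "\<lambda>w. if w then _ else _"])
      (use pB in auto)
  have [simp]: "3 + m = m + 3" by simp
  note rules = serve_win_A_def serve_win_B_def receive_win_A_def receive_win_B_def
  show ?thesis
  \<comment> \<open>The first eight goals are bounds; each of the others is the first-step equation
    at one kind of score, with the scoring rules evaluated at \<open>n = m + 4\<close>.\<close>
  proof (rule rally_values.intro, goal_cases)
    case (9 i j)
    then show ?case by (subst A) (auto simp: rules W)
  next
    case (10 i j)
    then show ?case by (subst B) (auto simp: rules W)
  next
    case (11 j)
    then show ?case by (subst A) (auto simp: rules W)
  next
    case (12 j)
    then show ?case by (subst A) (auto simp: rules W)
  next
    case (13 j)
    then show ?case by (subst B) (auto simp: rules W)
  next
    case (14 i)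
    then show ?case by (subst B) (auto simp: rules W)
  next
    case (15 i)
    then show ?case by (subst B) (auto simp: rules W)
  next
    case (16 i)
    then show ?case by (subst A) (auto simp: rules W)
  next
    case 17
    then show ?case by (subst A) (auto simp: rules W)
  next
    case 18
    then show ?case by (subst B) (auto simp: rules W)
  next
    case 19
    then show ?case by (subst A) (auto simp: rules W)
  next
    case 20
    then show ?case by (subst B) (auto simp: rules W)
  next
    case 21
    then show ?case by (subst A) (auto simp: rules W)
  next
    case 22
    then show ?case by (subst B) (auto simp: rules W)
  qed (simp_all add: pA pB H_def hitting_prob_bounds)
qed

theorem mainTheorem5:
  fixes pA pB qB :: real
  assumes "pA \<in> {0<..<1}" and "pB \<in> {0<..<1}" and "qB = 1 - pB"
  shows "(pA > qB \<longrightarrow> first_serve_advantage 21 pA pB > 0) \<and>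
         (pA < qB \<longrightarrow> first_serve_advantage 21 pA pB < 0)"
proof -
  \<comment> \<open>The game to 21 is the case \<open>m = 17\<close>, since the locale describes a
    game to \<open>m + 4\<close>.\<close>
  have "rally_values 17 pA pB
      (\<lambda>i j. hitting_prob (rally_step (17 + 4) pA pB) (Wins TeamA) (Rally i j TeamA))
      (\<lambda>i j. hitting_prob (rally_step (17 + 4) pA pB) (Wins TeamA) (Rally i j TeamB))"
    using assms by (intro rally_values_hitting_prob) auto
  from rally_values.serve_advantage[OF this]
  obtain w where "0 < w" "first_serve_advantage 21 pA pB = (pA + pB - 1) * w"
    unfolding first_serve_advantage_def prob_A_wins_def game_measure_def hitting_prob_def by auto
  then show ?thesis
    using assms(3) by (auto simp: zero_less_mult_iff mult_less_0_iff)
qed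

end
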